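(* Let $G$ be a finite Abelian group, $H\subset G$ a subgroup such that $G/H$ is cyclic, and $\rho\in G$ an element whose image in $G/H$ is a generator. Let $\Phi_\rho:\mathcal{C}(H)\to\mathcal{C}(G)$ be the monoscopic embedding along $\rho$ and $\vec s$ its beta ray. For any face $F\subset\mathcal{C}(H)$, the set $\mathbb{R}_{\ge 0}\vec s+\Phi_\rho(F)$ is a face of $\mathcal{C}(G)$ whose Kunz poset is the monoscopic extension along $\rho$ of the Kunz poset of $F$.
   Context: Group cone: for a finite Abelian group $G$ with $|G|=m$, the group cone $\mathcal{C}(G)\subset\mathbb{R}^{m-1}_{\ge 0}$ (coordinates indexed by $G\setminus\{0\}$) is the pointed cone of all points with non-negative coordinates satisfying $x_i+x_j\ge x_{i+j}$ for all $i,j\in G\setminus\{0\}$ with $i+j\ne 0$. (Non-negativity is implied by the other inequalities when $|G|\ge 3$.) By convention each point of $\mathcal{C}(G)$ is also given a coordinate $x_0=0$ indexed by the identity. Kunz subgroup and Kunz poset: for a face $F\subset\mathcal{C}(G)$, the set $K=\{g\in G: x_g=0\text{ for all }x\in F\}$ is a subgroup of $G$, called the Kunz subgroup of $F$; the Kunz poset of $F$ is the partial order on $G/K$ with unique minimal element $\overline 0$ and $\overline a\preceq\overline b$ whenever $x_a+x_{b-a}=x_b$ for all $x\in F$ ($a,b\in G$ distinct). This is known to be well defined. Monoscopic embedding: let $\beta=|G/H|$. Define $\Phi_\rho:\mathcal{C}(H)\to\mathcal{C}(G)$, $w\mapsto x$, by $x_{a+b\rho}=\beta w_a+b\,w_{\beta\rho}$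 for each $a\in H$ and each integer $0\le b<\beta$ (here $\beta\rho\in H$, and $w_0=0$). Beta ray: the vector $\vec s$ defined by $s_{a+b\rho}=b$ for each $a\in H$ and $0\le b\le\beta-1$. Monoscopic extension: let $P=(H/H',\preceq_P)$ be a poset, with $H'\subset H$ a subgroup. Every element of $G/H'$ is uniquely $a+b\rho$ with $a\in H/H'$, $0\le b\le\beta-1$. The monoscopic extension of $P$ along $\rho$ is the poset $Q=(G/H',\preceq_Q)$ with $a+b\rho\preceq_Q a'+b'\rho$ (for $a,a'\in H/H'$, $0\le b,b'\le\beta-1$) exactly when $a\preceq_P a'$ and $b\le b'$. *)

theory Defs
  imports
    "HOL-Analysis.Polytope"
    "HOL-Analysis.Finite_Function_Topology"
    "HOL-Algebra.Multiplicative_Group"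
begin

text \<open>
  Finite abelian groups are HOL-Algebra groups, hence written multiplicatively: \<open>a + b\<rho>\<close> becomes
  \<open>a \<otimes> \<rho> [^] b\<close>.  Points of \<open>\<real>\<^bsup>G - {0}\<^esup>\<close> are finitely supported functions on the
  ambient type whose support is contained in \<open>carrier G - {\<one>}\<close>; this builds in the convention
  \<open>x\<^sub>0 = 0\<close>.  For any subgroup \<open>H\<close>, the cone \<open>\<C>(H)\<close> is \<open>group_cone (G\<lparr>carrier := H\<rparr>)\<close>.
\<close>

definition group_cone :: "('g, 'm) monoid_scheme \<Rightarrow> ('g \<Rightarrow>\<^sub>0 real) set" where
  "group_cone G =
     {x. Poly_Mapping.keys x \<subseteq> carrier G - {\<one>\<^bsub>G\<^esub>} \<and>
         (\<forall>i \<in> carrier G - {\<one>\<^bsub>G\<^esub>}. 0 \<le> Poly_Mapping.lookup x i) \<and>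
         (\<forall>i \<in> carrier G - {\<one>\<^bsub>G\<^esub>}. \<forall>j \<in> carrier G - {\<one>\<^bsub>G\<^esub>}. i \<otimes>\<^bsub>G\<^esub> j \<noteq> \<one>\<^bsub>G\<^esub> \<longrightarrow>
            Poly_Mapping.lookup x i + Poly_Mapping.lookup x j \<ge> Poly_Mapping.lookup x (i \<otimes>\<^bsub>G\<^esub> j))}"

text \<open>
  The library relation \<open>face_of\<close> also counts the empty set as a face.  In the polyhedral convention
  (a face of a pointed cone is cut out by turning some defining inequalities into equations) every
  face contains the origin, so the empty set is excluded.
\<close>

definition cone_face :: "'a::real_vector set \<Rightarrow> 'a set \<Rightarrow> bool" where
  "cone_face F C \<longleftrightarrow> F face_of C \<and> F \<noteq> {}"

definition kunz_subgroup :: "('g, 'm) monoid_scheme \<Rightarrow> ('g \<Rightarrow>\<^sub>0 real) set \<Rightarrow> 'g set" where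
  "kunz_subgroup G F = {g \<in> carrier G. \<forall>x \<in> F. Poly_Mapping.lookup x g = 0}"

text \<open>
  A poset is a pair of its ground set and its order relation.  Independence of the representatives
  \<open>a\<close>, \<open>b\<close> is \<open>kunz_poset_rel_iff\<close> below; taking \<open>a = b\<close> gives reflexivity, as
  \<open>x\<^sub>0 = 0\<close>.
\<close>

definition kunz_poset ::
    "('g, 'm) monoid_scheme \<Rightarrow> ('g \<Rightarrow>\<^sub>0 real) set \<Rightarrow> 'g set set \<times> ('g set \<times> 'g set) set" where
  "kunz_poset G F =
     (let Q = carrier (G Mod kunz_subgroup G F) in
      (Q, {(A, B). A \<in> Q \<and> B \<in> Q \<and>
             (\<exists>a \<in> A. \<exists>b \<in> B. \<forall>x \<in> F.
                Poly_Mapping.lookup x a + Poly_Mapping.lookup x (b \<otimes>\<^bsub>G\<^esub> inv\<^bsub>G\<^esub> a)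
                  = Poly_Mapping.lookup x b)}))"

text \<open>
  The coordinates \<open>(a, b)\<close> of \<open>g = a + b\<rho>\<close> with \<open>a \<in> H\<close> and \<open>0 \<le> b < \<beta>\<close>, where
  \<open>\<beta> = |G/H|\<close>; they exist and are unique by \<open>mono_coords_ex1\<close> below.
\<close>

definition mono_coords :: "('g, 'm) monoid_scheme \<Rightarrow> 'g set \<Rightarrow> 'g \<Rightarrow> 'g \<Rightarrow> 'g \<times> nat" where
  "mono_coords G H \<rho> g =
     (THE (a, b). a \<in> H \<and> b < order (G Mod H) \<and> g = a \<otimes>\<^bsub>G\<^esub> \<rho> [^]\<^bsub>G\<^esub> b)"

definition mono_emb ::
    "('g, 'm) monoid_scheme \<Rightarrow> 'g set \<Rightarrow> 'g \<Rightarrow> ('g \<Rightarrow>\<^sub>0 real) \<Rightarrow> ('g \<Rightarrow>\<^sub>0 real)" where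
  "mono_emb G H \<rho> w = Abs_poly_mapping (\<lambda>g.
     if g \<in> carrier G then
       (case mono_coords G H \<rho> g of (a, b) \<Rightarrow>
          real (order (G Mod H)) * Poly_Mapping.lookup w a
            + real b * Poly_Mapping.lookup w (\<rho> [^]\<^bsub>G\<^esub> order (G Mod H)))
     else 0)"

definition beta_ray :: "('g, 'm) monoid_scheme \<Rightarrow> 'g set \<Rightarrow> 'g \<Rightarrow> ('g \<Rightarrow>\<^sub>0 real)" where
  "beta_ray G H \<rho> = Abs_poly_mapping (\<lambda>g.
     if g \<in> carrier G then (case mono_coords G H \<rho> g of (a, b) \<Rightarrow> real b) else 0)"

text \<open>
  In \<open>G/H'\<close> the element \<open>a + b\<rho>\<close> with \<open>a \<in> H/H'\<close> is the coset \<open>a\<close> (an element of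
  \<open>H/H'\<close> is literally also an element of \<open>G/H'\<close>) translated by \<open>\<rho> [^] b\<close>.
\<close>

definition mono_extension ::
    "('g, 'm) monoid_scheme \<Rightarrow> 'g set \<Rightarrow> 'g set \<Rightarrow> 'g \<Rightarrow>
     'g set set \<times> ('g set \<times> 'g set) set \<Rightarrow> 'g set set \<times> ('g set \<times> 'g set) set" where
  "mono_extension G H H' \<rho> P =
     (carrier (G Mod H'),
      {(A #>\<^bsub>G\<^esub> (\<rho> [^]\<^bsub>G\<^esub> b), A' #>\<^bsub>G\<^esub> (\<rho> [^]\<^bsub>G\<^esub> b')) | A A' b b'.
         A \<in> fst P \<and> A' \<in> fst P \<and> b < order (G Mod H) \<and> b' < order (G Mod H) \<and>
         (A, A') \<in> snd P \<and> b \<le> b'})"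


lemma mono_coords_ex1:
  fixes G (structure)
  assumes "comm_group G" "finite (carrier G)" "subgroup H G" "\<rho> \<in> carrier G"
    and gen: "subgroup_generated (G Mod H) {H #> \<rho>} = G Mod H"
    and g: "g \<in> carrier G"
  shows "\<exists>!p. fst p \<in> H \<and> snd p < order (G Mod H) \<and> g = fst p \<otimes> \<rho> [^] snd p"
proof -
  interpret comm_group G by fact
  interpret H: subgroup H G by fact
  interpret N: normal H G using assms(3) by (rule subgroup_imp_normal)
  interpret Q: group "G Mod H" by (rule N.factorgroup_is_group)
  let ?r = "H #> \<rho>"
  have r: "?r \<in> carrier (G Mod H)" using assms(4) by (auto simp: carrier_FactGroup)
  have fQ: "finite (carrier (G Mod H))" using assms(2) by (simp add: carrier_FactGroup)
  have gen': "generate (G Mod H) {?r} = carrier (G Mod H)"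
    using arg_cong[OF gen, of carrier] r by (simp add: carrier_subgroup_generated)
  have ord: "Q.ord ?r = order (G Mod H)"
    using Q.generate_pow_card[OF r] by (simp add: gen' order_def)
  have pos: "order (G Mod H) > 0" using fQ Q.order_gt_0_iff_finite by blast
  have surj: "carrier (G Mod H) = {?r [^]\<^bsub>G Mod H\<^esub> k | k. k \<in> (UNIV::nat set)}"
    using Q.generate_pow_nat[OF r] ord pos gen' by simp
  have pw: "?r [^]\<^bsub>G Mod H\<^esub> k = H #> (\<rho> [^] k)" for k :: nat
    using assms(4) by (rule N.FactGroup_pow)
  have "H #> g \<in> carrier (G Mod H)" using g by (auto simp: carrier_FactGroup)
  then have "H #> g \<in> {?r [^]\<^bsub>G Mod H\<^esub> k | k. k \<in> {0 .. order (G Mod H) - 1}}"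
    using Q.ord_elems[OF fQ r] unfolding surj ord by (rule subst[rotated])
  then obtain b where b: "b \<in> {0 .. order (G Mod H) - 1}" "H #> g = H #> (\<rho> [^] b)"
    unfolding pw by blast
  have "g \<in> H #> (\<rho> [^] b)" using b(2) g rcos_self assms(3) by blast
  then obtain a where a: "a \<in> H" "g = a \<otimes> \<rho> [^] b" by (auto simp: r_coset_def)
  have uniq: "b1 = b2" if "a1 \<in> H" "a2 \<in> H" "b1 < order (G Mod H)" "b2 < order (G Mod H)"
    "a1 \<otimes> \<rho> [^] b1 = a2 \<otimes> \<rho> [^] b2" for a1 a2 and b1 b2 :: nat
  proof -
    have *: "H #> (\<rho> [^] b1) = H #> (a1 \<otimes> \<rho> [^] b1)" if "a1 \<in> H" for a1 and b1 :: nat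
      using that assms(4) coset_mult_assoc[of H a1 "\<rho> [^] b1"] H.subset
      by (metis H.mem_carrier coset_join2 nat_pow_closed assms(3))
    have "?r [^]\<^bsub>G Mod H\<^esub> b1 = ?r [^]\<^bsub>G Mod H\<^esub> b2"
      using *[OF that(1), of b1] *[OF that(2), of b2] that(5) pw by simp
    moreover have "b1 \<in> {0 .. Q.ord ?r - 1}" "b2 \<in> {0 .. Q.ord ?r - 1}"
      using that(3,4) ord by auto
    ultimately show ?thesis using Q.ord_inj[OF r] by (auto dest: inj_onD)
  qed
  show ?thesis
  proof (rule ex1I[of _ "(a, b)"])
    show "fst (a, b) \<in> H \<and> snd (a, b) < order (G Mod H) \<and> g = fst (a, b) \<otimes> \<rho> [^] snd (a, b)"
      using a b pos by auto
    fix p assume p: "fst p \<in> H \<and> snd p < order (G Mod H) \<and> g = fst p \<otimes> \<rho> [^] snd p"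
    have "snd p = b" using uniq[of "fst p" a "snd p" b] p a b pos by auto
    moreover from this have "fst p = a" using p a assms(4) by (metis H.mem_carrier nat_pow_closed right_cancel)
    ultimately show "p = (a, b)" by (metis prod.collapse)
  qed
qed

lemma mono_coords_eq:
  fixes G (structure)
  assumes "comm_group G" "finite (carrier G)" "subgroup H G" "\<rho> \<in> carrier G"
    and "subgroup_generated (G Mod H) {H #> \<rho>} = G Mod H"
    and "a \<in> H" "b < order (G Mod H)"
  shows "mono_coords G H \<rho> (a \<otimes> \<rho> [^] b) = (a, b)"
proof -
  interpret comm_group G by fact
  have g: "a \<otimes> \<rho> [^] b \<in> carrier G"
    using assms(3,4,6) by (meson m_closed nat_pow_closed subgroup.mem_carrier)
  show ?thesis
    unfolding mono_coords_def case_prod_beta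
    by (rule the1_equality[OF mono_coords_ex1[OF assms(1-5) g]]) (use assms(6,7) in simp)
qed

lemma lookup_mono_emb:
  fixes G (structure)
  assumes "comm_group G" "finite (carrier G)" "subgroup H G" "\<rho> \<in> carrier G"
    and "subgroup_generated (G Mod H) {H #> \<rho>} = G Mod H"
    and "a \<in> H" "b < order (G Mod H)"
  shows "Poly_Mapping.lookup (mono_emb G H \<rho> w) (a \<otimes> \<rho> [^] b) =
      real (order (G Mod H)) * Poly_Mapping.lookup w a
        + real b * Poly_Mapping.lookup w (\<rho> [^] order (G Mod H))"
proof -
  interpret comm_group G by fact
  have g: "a \<otimes> \<rho> [^] b \<in> carrier G"
    using assms(3,4,6) by (meson m_closed nat_pow_closed subgroup.mem_carrier)
  show ?thesis
    unfolding mono_emb_def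
    by (subst Abs_poly_mapping_inverse)
       (use g mono_coords_eq[OF assms] in \<open>auto intro: finite_subset[OF _ assms(2)]\<close>)
qed

lemma lookup_beta_ray:
  fixes G (structure)
  assumes "comm_group G" "finite (carrier G)" "subgroup H G" "\<rho> \<in> carrier G"
    and "subgroup_generated (G Mod H) {H #> \<rho>} = G Mod H"
    and "a \<in> H" "b < order (G Mod H)"
  shows "Poly_Mapping.lookup (beta_ray G H \<rho>) (a \<otimes> \<rho> [^] b) = real b"
proof -
  interpret comm_group G by fact
  have g: "a \<otimes> \<rho> [^] b \<in> carrier G"
    using assms(3,4,6) by (meson m_closed nat_pow_closed subgroup.mem_carrier)
  show ?thesis
    unfolding beta_ray_def
    by (subst Abs_poly_mapping_inverse)
       (use g mono_coords_eq[OF assms] in \<open>auto intro: finite_subset[OF _ assms(2)]\<close>)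
qed

lemma group_cone_one: "x \<in> group_cone G \<Longrightarrow> Poly_Mapping.lookup x \<one>\<^bsub>G\<^esub> = 0"
  by (auto simp: group_cone_def in_keys_iff)

lemma group_cone_nonneg: "x \<in> group_cone G \<Longrightarrow> g \<in> carrier G \<Longrightarrow> 0 \<le> Poly_Mapping.lookup x g"
  using group_cone_one[of x G] by (cases "g = \<one>\<^bsub>G\<^esub>") (auto simp: group_cone_def)

lemma group_cone_subadd:
  fixes G (structure)
  assumes "comm_group G" "x \<in> group_cone G" "i \<in> carrier G" "j \<in> carrier G"
  shows "Poly_Mapping.lookup x (i \<otimes> j) \<le> Poly_Mapping.lookup x i + Poly_Mapping.lookup x j"
proof -
  interpret comm_group G by fact
  show ?thesis
  proof (cases "i = \<one> \<or> j = \<one> \<or> i \<otimes> j = \<one>")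
    case True
    then show ?thesis
      using group_cone_one[OF assms(2)] group_cone_nonneg[OF assms(2)] assms(3,4) by auto
  next
    case False
    then show ?thesis using assms by (auto simp: group_cone_def)
  qed
qed

lemma subgroup_kunz_subgroup:
  fixes G (structure)
  assumes "comm_group G" "finite (carrier G)" "F \<subseteq> group_cone G"
  shows "subgroup (kunz_subgroup G F) G"
proof -
  interpret comm_group G by fact
  have one: "\<one> \<in> kunz_subgroup G F"
    using assms(3) group_cone_one by (auto simp: kunz_subgroup_def)
  have mult: "a \<otimes> b \<in> kunz_subgroup G F" if "a \<in> kunz_subgroup G F" "b \<in> kunz_subgroup G F" for a b
  proof -
    have ab: "a \<in> carrier G" "b \<in> carrier G" using that by (auto simp: kunz_subgroup_def)
    have "Poly_Mapping.lookup x (a \<otimes> b) = 0" if "x \<in> F" for x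
    proof -
      have x: "x \<in> group_cone G" using that assms(3) by blast
      have "Poly_Mapping.lookup x a = 0" "Poly_Mapping.lookup x b = 0"
        using \<open>a \<in> kunz_subgroup G F\<close> \<open>b \<in> kunz_subgroup G F\<close> \<open>x \<in> F\<close>
        by (auto simp: kunz_subgroup_def)
      then show ?thesis
        using group_cone_subadd[OF assms(1) x ab] group_cone_nonneg[OF x m_closed[OF ab]] by linarith
    qed
    then show ?thesis using ab by (simp add: kunz_subgroup_def)
  qed
  have pow: "a [^] n \<in> kunz_subgroup G F" if "a \<in> kunz_subgroup G F" for a and n :: nat
    using that one mult by (induction n) auto
  have "inv a \<in> kunz_subgroup G F" if a: "a \<in> kunz_subgroup G F" for a
  proof -
    have ac: "a \<in> carrier G" using a by (simp add: kunz_subgroup_def)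
    have "order G > 0" using assms(2) order_gt_0_iff_finite by blast
    then have "a \<otimes> a [^] (order G - 1) = \<one>"
      using pow_order_eq_1[OF ac] ac nat_pow_Suc2[of a "order G - 1"] by simp
    then have "inv a = a [^] (order G - 1)" using ac by (metis inv_equality m_comm nat_pow_closed)
    then show ?thesis using pow[OF a] by simp
  qed
  then show ?thesis
    using one mult by unfold_locales (auto simp: kunz_subgroup_def)
qed

lemma kunz_coset_const:
  fixes G (structure)
  assumes "comm_group G" "finite (carrier G)" "F \<subseteq> group_cone G"
    and "x \<in> F" "k \<in> kunz_subgroup G F" "g \<in> carrier G"
  shows "Poly_Mapping.lookup x (k \<otimes> g) = Poly_Mapping.lookup x g"
proof -
  interpret comm_group G by fact
  interpret K: subgroup "kunz_subgroup G F" G using assms(1-3) by (rule subgroup_kunz_subgroup)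
  have x: "x \<in> group_cone G" using assms by blast
  have k: "k \<in> carrier G" "Poly_Mapping.lookup x k = 0" "Poly_Mapping.lookup x (inv k) = 0"
    using assms(4) assms(5) K.m_inv_closed[OF assms(5)] unfolding kunz_subgroup_def by blast+
  have "inv k \<otimes> (k \<otimes> g) = g" using k assms(6) by (simp flip: m_assoc)
  then show ?thesis
    using group_cone_subadd[OF assms(1) x, of k g] group_cone_subadd[OF assms(1) x, of "inv k" "k \<otimes> g"]
      k assms(6) by simp
qed

lemma kunz_poset_rel_iff:
  fixes G (structure)
  assumes "comm_group G" "finite (carrier G)" "F \<subseteq> group_cone G"
    and a: "a \<in> carrier G" and b: "b \<in> carrier G"
  shows "(kunz_subgroup G F #> a, kunz_subgroup G F #> b) \<in> snd (kunz_poset G F) \<longleftrightarrow>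
    (\<forall>x \<in> F. Poly_Mapping.lookup x a + Poly_Mapping.lookup x (b \<otimes> inv a) = Poly_Mapping.lookup x b)"
proof -
  interpret comm_group G by fact
  let ?K = "kunz_subgroup G F"
  interpret K: subgroup ?K G using assms(1-3) by (rule subgroup_kunz_subgroup)
  note const = kunz_coset_const[OF assms(1-3)]
  have "(\<forall>x \<in> F. Poly_Mapping.lookup x a' + Poly_Mapping.lookup x (b' \<otimes> inv a') = Poly_Mapping.lookup x b')
     \<longleftrightarrow> (\<forall>x \<in> F. Poly_Mapping.lookup x a + Poly_Mapping.lookup x (b \<otimes> inv a) = Poly_Mapping.lookup x b)"
    if "a' \<in> ?K #> a" "b' \<in> ?K #> b" for a' b'
  proof -
    obtain k l where k: "k \<in> ?K" "a' = k \<otimes> a" and l: "l \<in> ?K" "b' = l \<otimes> b"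
      using \<open>a' \<in> ?K #> a\<close> \<open>b' \<in> ?K #> b\<close> by (auto simp: r_coset_def)
    have "b' \<otimes> inv a' = (l \<otimes> inv k) \<otimes> (b \<otimes> inv a)"
      using k l a b by (simp add: inv_mult m_ac)
    moreover have "l \<otimes> inv k \<in> ?K" using k l by simp
    ultimately show ?thesis using const k l a b by simp
  qed
  moreover have "a \<in> ?K #> a" "b \<in> ?K #> b" using a b K.subgroup_axioms rcos_self by blast+
  moreover have "?K #> a \<in> carrier (G Mod ?K)" "?K #> b \<in> carrier (G Mod ?K)"
    using a b unfolding carrier_FactGroup by blast+
  ultimately show ?thesis
    unfolding kunz_poset_def Let_def snd_conv mem_Collect_eq prod.case by blast
qed

lemma partial_order_kunz_poset:
  fixes G (structure)
  assumes "comm_group G" "finite (carrier G)" "F \<subseteq> group_cone G"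
  shows "partial_order_on (fst (kunz_poset G F)) (snd (kunz_poset G F))"
proof -
  interpret comm_group G by fact
  let ?K = "kunz_subgroup G F" and ?R = "snd (kunz_poset G F)"
  interpret K: subgroup ?K G using assms(1-3) by (rule subgroup_kunz_subgroup)
  note iff = kunz_poset_rel_iff[OF assms]
  have fst: "fst (kunz_poset G F) = (\<lambda>a. ?K #> a) ` carrier G"
    by (simp add: kunz_poset_def Let_def carrier_FactGroup)
  have reps: "\<exists>a b. a \<in> carrier G \<and> b \<in> carrier G \<and> A = ?K #> a \<and> B = ?K #> b"
    if "(A, B) \<in> ?R" for A B
    using that by (auto simp: kunz_poset_def Let_def carrier_FactGroup)
  have one: "\<forall>x \<in> F. Poly_Mapping.lookup x \<one> = 0" using assms(3) group_cone_one by blast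
  have refl: "refl_on (fst (kunz_poset G F)) ?R"
    by (auto simp: refl_on_def fst iff one)
  have trans: "trans ?R"
  proof (rule transI)
    fix A B C assume AB: "(A, B) \<in> ?R" and BC: "(B, C) \<in> ?R"
    obtain a b where ab: "a \<in> carrier G" "b \<in> carrier G" "A = ?K #> a" "B = ?K #> b"
      using reps[OF AB] by blast
    obtain c where c: "c \<in> carrier G" "C = ?K #> c" using reps[OF BC] by blast
    have "Poly_Mapping.lookup x a + Poly_Mapping.lookup x (c \<otimes> inv a) = Poly_Mapping.lookup x c"
      if "x \<in> F" for x
    proof -
      have x: "x \<in> group_cone G" using that assms by blast
      have "(c \<otimes> inv b) \<otimes> (b \<otimes> inv a) = c \<otimes> (inv b \<otimes> b) \<otimes> inv a"
        using ab c by (simp only: m_assoc inv_closed m_closed)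
      then have 1: "(c \<otimes> inv b) \<otimes> (b \<otimes> inv a) = c \<otimes> inv a" using ab c by simp
      have "a \<otimes> (c \<otimes> inv a) = c \<otimes> (a \<otimes> inv a)" using ab c by (simp only: m_lcomm inv_closed)
      then have 2: "a \<otimes> (c \<otimes> inv a) = c" using ab c by simp
      have "Poly_Mapping.lookup x a + Poly_Mapping.lookup x (b \<otimes> inv a) = Poly_Mapping.lookup x b"
        using AB that unfolding ab(3,4) iff[OF ab(1,2)] by (rule bspec)
      moreover have "Poly_Mapping.lookup x b + Poly_Mapping.lookup x (c \<otimes> inv b) = Poly_Mapping.lookup x c"
        using BC that unfolding ab(4) c(2) iff[OF ab(2) c(1)] by (rule bspec)
      moreover have "Poly_Mapping.lookup x (c \<otimes> inv a)
          \<le> Poly_Mapping.lookup x (c \<otimes> inv b) + Poly_Mapping.lookup x (b \<otimes> inv a)"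
        using group_cone_subadd[OF assms(1) x, of "c \<otimes> inv b" "b \<otimes> inv a"] 1 ab(1,2) c(1) by simp
      moreover have "Poly_Mapping.lookup x c
          \<le> Poly_Mapping.lookup x a + Poly_Mapping.lookup x (c \<otimes> inv a)"
        using group_cone_subadd[OF assms(1) x, of a "c \<otimes> inv a"] 2 ab(1) c(1) by simp
      ultimately show ?thesis by linarith
    qed
    then show "(A, C) \<in> ?R" using iff ab c by simp
  qed
  have "antisym ?R"
  proof (rule antisymI)
    fix A B assume AB: "(A, B) \<in> ?R" and BA: "(B, A) \<in> ?R"
    obtain a b where ab: "a \<in> carrier G" "b \<in> carrier G" "A = ?K #> a" "B = ?K #> b"
      using reps[OF AB] by blast
    have "Poly_Mapping.lookup x (b \<otimes> inv a) = 0" if "x \<in> F" for x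
    proof -
      have x: "x \<in> group_cone G" using that assms by blast
      have "Poly_Mapping.lookup x a + Poly_Mapping.lookup x (b \<otimes> inv a) = Poly_Mapping.lookup x b"
        using AB that unfolding ab(3,4) iff[OF ab(1,2)] by (rule bspec)
      moreover have "Poly_Mapping.lookup x b + Poly_Mapping.lookup x (a \<otimes> inv b) = Poly_Mapping.lookup x a"
        using BA that unfolding ab(3,4) iff[OF ab(2,1)] by (rule bspec)
      moreover have "0 \<le> Poly_Mapping.lookup x (b \<otimes> inv a)" "0 \<le> Poly_Mapping.lookup x (a \<otimes> inv b)"
        using ab(1,2) by (auto intro: group_cone_nonneg[OF x])
      ultimately show ?thesis by linarith
    qed
    moreover have "b \<otimes> inv a \<in> carrier G" using ab(1,2) by simp
    ultimately have "b \<otimes> inv a \<in> ?K" unfolding kunz_subgroup_def by blast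
    moreover have "b = (b \<otimes> inv a) \<otimes> a" using ab(1,2) by (simp add: m_assoc)
    ultimately have "b \<in> ?K #> a" unfolding r_coset_def by blast
    then show "A = B"
      unfolding ab(3,4) by (rule repr_independence[OF _ ab(1) K.subgroup_axioms])
  qed
  moreover have "?R \<subseteq> fst (kunz_poset G F) \<times> fst (kunz_poset G F)"
    unfolding fst
  proof clarify
    fix A B assume "(A, B) \<in> ?R"
    from reps[OF this] show "A \<in> (\<lambda>a. ?K #> a) ` carrier G \<and> B \<in> (\<lambda>a. ?K #> a) ` carrier G"
      by blast
  qed
  ultimately show ?thesis
    using refl trans unfolding partial_order_on_def preorder_on_def by blast
qed

end

theory Submission
  imports Defs
begin

text \<open>
  Every point of \<open>\<C>(G)\<close> satisfies \<open>x\<^bsub>a + b\<rho>\<^esub> \<le> x\<^sub>a + b x\<^sub>\<rho>\<close> for \<open>a \<in> H\<close> and \<open>b < \<beta>\<close>, since this is a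
  sum of defining inequalities.  Turning these into equations cuts out a face of \<open>\<C>(G)\<close>; on it \<open>x\<close> is
  determined by \<open>w = x|\<^sub>H / \<beta> \<in> \<C>(H)\<close> and \<open>x\<^sub>\<rho>\<close>, namely \<open>x = t s + \<Phi>(w)\<close> with
  \<open>t = x\<^sub>\<rho> - w\<^bsub>\<beta>\<rho>\<^esub> \<ge> 0\<close>.  Requiring \<open>w \<in> F\<close> in addition gives the face of the theorem, because the
  preimage of a face under a linear map is a face.  In the Kunz poset, points with \<open>t > 0\<close> make the
  inequality for \<open>a + b\<rho> \<preceq> a' + b'\<rho>\<close> strict as soon as \<open>b > b'\<close>, where a carry of \<open>\<beta>\<rho>\<close> occurs.
\<close>

section \<open>Scalar multiples, and faces cut out by linear maps and nonnegative forms\<close>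

abbreviation lookup :: "('a \<Rightarrow>\<^sub>0 real) \<Rightarrow> 'a \<Rightarrow> real" where
  "lookup \<equiv> Poly_Mapping.lookup"

lemma lookup_scaleR: "lookup (c *\<^sub>R x) i = c * lookup x i" for x :: "'a \<Rightarrow>\<^sub>0 real"
proof -
  have "finite {i. c *\<^sub>R lookup x i \<noteq> 0}"
    by (rule finite_subset[OF _ finite_keys[of x]]) (auto simp: in_keys_iff)
  then show ?thesis
    by (simp add: scaleR_poly_mapping_def)
qed

text \<open>A linear map sends an open segment into the open segment between the images of its
  endpoints, so the face property of \<open>T\<close> applies there. If the endpoints have the same
  image, that open segment is empty; but then \<open>f\<close> is constant on the segment and
  \<open>f x\<close> itself is the common value.\<close>

lemma face_of_linear_vimage:
  assumes "linear f" "T face_of S'" "f ` S \<subseteq> S'" "convex S"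
  shows "{x \<in> S. f x \<in> T} face_of S"
proof -
  have conv: "convex {x \<in> S. f x \<in> T}"
  proof -
    have "{x \<in> S. f x \<in> T} = S \<inter> f -` T" by auto
    then show ?thesis
      using assms face_of_imp_convex by (metis convex_Int convex_linear_vimage)
  qed
  have "f a \<in> T \<and> f b \<in> T"
    if ab: "a \<in> S" "b \<in> S" and x: "f x \<in> T" "x \<in> open_segment a b" for a b x
  proof (cases "f a = f b")
    case True
    obtain u where "x = (1 - u) *\<^sub>R a + u *\<^sub>R b" using x(2) by (auto simp: in_segment)
    then have "f x = f b" using assms(1) True
      by (simp add: linear_add linear_scale flip: scaleR_left_distrib)
    then show ?thesis using x(1) True by simp
  next
    case False
    obtain u where u: "0 < u" "u < 1" "x = (1 - u) *\<^sub>R a + u *\<^sub>R b"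
      using x(2) by (auto simp: in_segment)
    then have "f x = (1 - u) *\<^sub>R f a + u *\<^sub>R f b"
      using assms(1) by (simp add: linear_add linear_scale)
    then have "f x \<in> open_segment (f a) (f b)" using False u by (auto simp: in_segment)
    then show ?thesis using face_ofD[OF assms(2)] ab x(1) assms(3) by blast
  qed
  with conv show ?thesis unfolding face_of_def by blast
qed

text \<open>At an interior point of a segment a linear form is a combination of its two end values
  with positive weights. If the end values are nonnegative and the combination vanishes, both must
  vanish.\<close>

lemma face_of_linear_zeros:
  fixes l :: "'i \<Rightarrow> 'a::real_vector \<Rightarrow> real"
  assumes "convex S" and lin: "\<And>i. i \<in> I \<Longrightarrow> linear (l i)"
    and nonneg: "\<And>i x. i \<in> I \<Longrightarrow> x \<in> S \<Longrightarrow> 0 \<le> l i x"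
  shows "{x \<in> S. \<forall>i \<in> I. l i x = 0} face_of S"
proof -
  have comb: "l i (u *\<^sub>R a + v *\<^sub>R b) = u * l i a + v * l i b" if "i \<in> I" for i u v a b
    using lin[OF that] by (simp add: linear_add linear_scale)
  have "convex {x \<in> S. \<forall>i \<in> I. l i x = 0}"
    using assms(1) unfolding convex_def by (auto simp: comb)
  moreover have "l i a = 0 \<and> l i b = 0"
    if i: "i \<in> I" and ab: "a \<in> S" "b \<in> S" and x: "l i x = 0" "x \<in> open_segment a b" for a b x i
  proof -
    obtain u where u: "0 < u" "u < 1" "x = (1 - u) *\<^sub>R a + u *\<^sub>R b"
      using x(2) by (auto simp: in_segment)
    then have "(1 - u) * l i a + u * l i b = 0" using i x(1) comb by simp
    moreover have "0 \<le> (1 - u) * l i a" "0 \<le> u * l i b" using u nonneg i ab by simp_all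
    ultimately have "(1 - u) * l i a = 0" "u * l i b = 0" by linarith+
    then show ?thesis using u by simp
  qed
  ultimately show ?thesis unfolding face_of_def by blast
qed

section \<open>Convexity of group cones and restriction to a subgroup\<close>

lemma convex_group_cone: "convex (group_cone G)"
proof (rule convexI)
  fix x y :: "'a \<Rightarrow>\<^sub>0 real" and u v :: real
  assume xy: "x \<in> group_cone G" "y \<in> group_cone G" and uv: "0 \<le> u" "0 \<le> v" "u + v = 1"
  have lk: "lookup (u *\<^sub>R x + v *\<^sub>R y) i = u * lookup x i + v * lookup y i" for i
    by (simp add: lookup_add lookup_scaleR)
  have "u * lookup x (i \<otimes>\<^bsub>G\<^esub> j) + v * lookup y (i \<otimes>\<^bsub>G\<^esub> j)
      \<le> u * lookup x i + v * lookup y i + (u * lookup x j + v * lookup y j)"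
    if "lookup x (i \<otimes>\<^bsub>G\<^esub> j) \<le> lookup x i + lookup x j" "lookup y (i \<otimes>\<^bsub>G\<^esub> j) \<le> lookup y i + lookup y j" for i j
    using mult_left_mono[OF that(1) uv(1)] mult_left_mono[OF that(2) uv(2)]
    by (simp add: algebra_simps)
  moreover have "Poly_Mapping.keys (u *\<^sub>R x + v *\<^sub>R y) \<subseteq> carrier G - {\<one>\<^bsub>G\<^esub>}"
  proof
    fix i assume "i \<in> Poly_Mapping.keys (u *\<^sub>R x + v *\<^sub>R y)"
    then have "i \<in> Poly_Mapping.keys x \<or> i \<in> Poly_Mapping.keys y"
      by (auto simp: in_keys_iff lk)
    then show "i \<in> carrier G - {\<one>\<^bsub>G\<^esub>}" using xy by (auto simp: group_cone_def)
  qed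
  ultimately show "u *\<^sub>R x + v *\<^sub>R y \<in> group_cone G"
    using xy uv unfolding group_cone_def lk mem_Collect_eq by auto
qed

text \<open>Points of the cones of \<open>G\<close> and of \<open>H\<close> share one type, so
  restriction is zero-filling outside \<open>A\<close> and thereby a linear endomorphism, to which
  \<open>face_of_linear_vimage\<close> applies.\<close>

definition pm_restrict :: "'a set \<Rightarrow> ('a \<Rightarrow>\<^sub>0 real) \<Rightarrow> ('a \<Rightarrow>\<^sub>0 real)" where
  "pm_restrict A x = Abs_poly_mapping (\<lambda>i. if i \<in> A then lookup x i else 0)"

lemma lookup_pm_restrict: "lookup (pm_restrict A x) i = (if i \<in> A then lookup x i else 0)"
proof -
  have "finite {i. (if i \<in> A then lookup x i else 0) \<noteq> 0}"
    by (rule finite_subset[OF _ finite_keys[of x]]) (auto simp: in_keys_iff)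
  then show ?thesis by (simp add: pm_restrict_def)
qed

lemma linear_pm_restrict: "linear (pm_restrict A)"
  by (rule linearI) (auto intro!: poly_mapping_eqI simp: lookup_pm_restrict lookup_add lookup_scaleR)

text \<open>Used with \<open>c = 1 / \<beta>\<close>, which undoes the factor \<open>\<beta>\<close>
  that the monoscopic embedding puts on the coordinates in \<open>H\<close>.\<close>

lemma scaled_pm_restrict_group_cone:
  assumes "subgroup H G" "x \<in> group_cone G" "0 \<le> c"
  shows "c *\<^sub>R pm_restrict H x \<in> group_cone (G\<lparr>carrier := H\<rparr>)"
proof -
  interpret subgroup H G by fact
  have "c * lookup x (i \<otimes>\<^bsub>G\<^esub> j) \<le> c * lookup x i + c * lookup x j"
    if "lookup x (i \<otimes>\<^bsub>G\<^esub> j) \<le> lookup x i + lookup x j" for i j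
    using mult_left_mono[OF that assms(3)] by (simp add: algebra_simps)
  then show ?thesis
    using assms(2,3) subset
    by (auto simp: group_cone_def in_keys_iff lookup_pm_restrict lookup_scaleR split: if_splits)
qed

section \<open>Coordinates relative to \<open>H\<close> and \<open>\<rho>\<close>, and addition with
  carry\<close>

locale monoscopic = comm_group G for G :: "('g, 'm) monoid_scheme" (structure) +
  fixes H :: "'g set" and \<rho> :: 'g
  assumes finite_G: "finite (carrier G)" and subgroup_H: "subgroup H G" and rho: "\<rho> \<in> carrier G"
    and gen: "subgroup_generated (G Mod H) {H #> \<rho>} = G Mod H"
begin

sublocale H: subgroup H G by (rule subgroup_H)

abbreviation "GH \<equiv> G\<lparr>carrier := H\<rparr>"
abbreviation "\<beta> \<equiv> order (G Mod H)"
abbreviation "r \<equiv> \<rho> [^] \<beta>"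

lemma comm_group_G: "comm_group G" by unfold_locales

lemma H_closed: "a \<in> H \<Longrightarrow> a \<in> carrier G"
  by (rule H.mem_carrier)

lemma comm_group_GH: "comm_group GH"
  by (rule group.group_comm_groupI[OF H.subgroup_is_group]) (use H_closed in \<open>auto simp: m_comm is_group\<close>)

lemma finite_GH: "finite (carrier GH)"
  using finite_G H.subset finite_subset by auto

lemma rpow: "\<rho> [^] (n::nat) \<in> carrier G"
  using rho by simp

lemma beta_pos: "0 < \<beta>"
proof -
  interpret N: normal H G using subgroup_H by (rule subgroup_imp_normal)
  interpret Q: group "G Mod H" by (rule N.factorgroup_is_group)
  show ?thesis using finite_G Q.order_gt_0_iff_finite by (simp add: carrier_FactGroup)
qed

text \<open>By Lagrange's theorem in the quotient, raising the coset of \<open>\<rho>\<close> to the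
  power \<open>\<beta>\<close> gives the identity coset \<open>H\<close>.\<close>

lemma r_in_H: "r \<in> H"
proof -
  interpret N: normal H G using subgroup_H by (rule subgroup_imp_normal)
  interpret Q: group "G Mod H" by (rule N.factorgroup_is_group)
  have "H #> \<rho> \<in> carrier (G Mod H)" using rho by (auto simp: carrier_FactGroup)
  then have "H #> r = H"
    using Q.pow_order_eq_1[of "H #> \<rho>"] N.FactGroup_pow[OF rho, of \<beta>] by simp
  then show ?thesis using rcos_self[OF rpow subgroup_H] by metis
qed

lemma coords:
  assumes "g \<in> carrier G"
  obtains a b where "a \<in> H" "b < \<beta>" "g = a \<otimes> \<rho> [^] (b::nat)"
  using mono_coords_ex1[OF comm_group_G finite_G subgroup_H rho gen assms] by auto

lemma elem_closed: "a \<in> H \<Longrightarrow> a \<otimes> \<rho> [^] (b::nat) \<in> carrier G"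
  using H_closed rpow by simp

lemma elem_mult:
  assumes "a \<in> H" "a' \<in> H"
  shows "(a \<otimes> \<rho> [^] b) \<otimes> (a' \<otimes> \<rho> [^] b') = (a \<otimes> a') \<otimes> \<rho> [^] (b + b' :: nat)"
  using assms H_closed rpow rho by (simp add: m_ac flip: nat_pow_mult)

text \<open>Addition with a carry: when the exponents of \<open>\<rho>\<close> overflow,
  \<open>\<beta>\<close> of them are traded for the factor \<open>r\<close> of the
  \<open>H\<close>-coordinate.\<close>

lemma elem_mult_carry:
  assumes "a \<in> H" "a' \<in> H" "\<beta> \<le> b + b'"
  shows "(a \<otimes> \<rho> [^] b) \<otimes> (a' \<otimes> \<rho> [^] b') = (a \<otimes> a' \<otimes> r) \<otimes> \<rho> [^] (b + b' - \<beta>)"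
proof -
  have "\<rho> [^] (b + b') = r \<otimes> \<rho> [^] (b + b' - \<beta>)"
    using assms(3) rho by (simp add: nat_pow_mult)
  then show ?thesis
    unfolding elem_mult[OF assms(1,2)] using assms H_closed rpow by (simp add: m_assoc)
qed

section \<open>Points spanned by the beta ray and the embedding\<close>

text \<open>For fixed \<open>a\<close> the coordinates of such a point are affine in
  \<open>b\<close>, with the slope \<open>lookup w r + t\<close> common to all \<open>a\<close>.
  This form makes the later comparisons short.\<close>

definition mono_point :: "real \<Rightarrow> ('g \<Rightarrow>\<^sub>0 real) \<Rightarrow> ('g \<Rightarrow>\<^sub>0 real)" where
  "mono_point t w = t *\<^sub>R beta_ray G H \<rho> + mono_emb G H \<rho> w"

lemma lookup_mono_point:
  assumes "a \<in> H" "b < \<beta>"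
  shows "lookup (mono_point t w) (a \<otimes> \<rho> [^] b) = real \<beta> * lookup w a + real b * (lookup w r + t)"
  using lookup_beta_ray[OF comm_group_G finite_G subgroup_H rho gen assms]
    lookup_mono_emb[OF comm_group_G finite_G subgroup_H rho gen assms]
  by (simp add: mono_point_def lookup_add lookup_scaleR algebra_simps)

lemma lookup_mono_point_H: "a \<in> H \<Longrightarrow> lookup (mono_point t w) a = real \<beta> * lookup w a"
  using lookup_mono_point[of a 0 t w] beta_pos H_closed by simp

lemma lookup_mono_point_outside: "g \<notin> carrier G \<Longrightarrow> lookup (mono_point t w) g = 0"
  unfolding mono_point_def lookup_add lookup_scaleR beta_ray_def mono_emb_def
  by (subst (1 2) Abs_poly_mapping_inverse) (auto intro: finite_subset[OF _ finite_G])

lemma cone_nonneg: "w \<in> group_cone GH \<Longrightarrow> a \<in> H \<Longrightarrow> 0 \<le> lookup w a"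
  using group_cone_nonneg[of w GH a] by simp

lemma cone_subadd: "w \<in> group_cone GH \<Longrightarrow> a \<in> H \<Longrightarrow> a' \<in> H \<Longrightarrow> lookup w (a \<otimes> a') \<le> lookup w a + lookup w a'"
  using group_cone_subadd[OF comm_group_GH, of w a a'] by simp

lemma cone_subadd3:
  assumes "w \<in> group_cone GH" "a \<in> H" "a' \<in> H" "c \<in> H"
  shows "lookup w (a \<otimes> a' \<otimes> c) \<le> lookup w a + lookup w a' + lookup w c"
  using cone_subadd[OF assms(1), of "a \<otimes> a'" c] cone_subadd[OF assms(1), of a a'] assms by simp

text \<open>Without a carry the terms in \<open>b\<close> and \<open>b'\<close> add up exactly, and
  what remains is \<open>\<beta>\<close> times subadditivity of \<open>w\<close>. With a carry the
  left side loses \<open>\<beta>\<close> times the slope: \<open>\<beta> * lookup w r\<close> of it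
  pays for the extra factor \<open>r\<close>, and the rest is the slack \<open>\<beta> * t\<close>,
  which is nonnegative.\<close>

lemma mono_point_in_cone:
  assumes w: "w \<in> group_cone GH" and t: "0 \<le> t"
  shows "mono_point t w \<in> group_cone G"
proof -
  have nonneg: "0 \<le> lookup (mono_point t w) g" if "g \<in> carrier G" for g
    using that
  proof (rule coords)
    fix a b assume "a \<in> H" "b < \<beta>" "g = a \<otimes> \<rho> [^] (b::nat)"
    then show ?thesis using lookup_mono_point cone_nonneg[OF w] r_in_H t by simp
  qed
  have subadd: "lookup (mono_point t w) (g \<otimes> h) \<le> lookup (mono_point t w) g + lookup (mono_point t w) h"
    if gh: "g \<in> carrier G" "h \<in> carrier G" for g h
  proof -
    obtain a b where ab: "a \<in> H" "b < \<beta>" "g = a \<otimes> \<rho> [^] (b::nat)" using coords[OF gh(1)] .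
    obtain a' b' where ab': "a' \<in> H" "b' < \<beta>" "h = a' \<otimes> \<rho> [^] (b'::nat)" using coords[OF gh(2)] .
    have aa: "a \<otimes> a' \<in> H" "a \<otimes> a' \<otimes> r \<in> H" using ab ab' r_in_H by simp_all
    show ?thesis
    proof (cases "b + b' < \<beta>")
      case True
      have "lookup (mono_point t w) (g \<otimes> h) = real \<beta> * lookup w (a \<otimes> a') + real (b + b') * (lookup w r + t)"
        unfolding ab(3) ab'(3) elem_mult[OF ab(1) ab'(1)] by (rule lookup_mono_point[OF aa(1) True])
      moreover have "real \<beta> * lookup w (a \<otimes> a') \<le> real \<beta> * (lookup w a + lookup w a')"
        using cone_subadd[OF w ab(1) ab'(1)] by (intro mult_left_mono) auto
      ultimately show ?thesis
        using ab ab' by (simp add: lookup_mono_point algebra_simps)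
    next
      case False
      then have le: "\<beta> \<le> b + b'" and lt: "b + b' - \<beta> < \<beta>" using ab ab' by auto
      have "lookup (mono_point t w) (g \<otimes> h)
          = real \<beta> * lookup w (a \<otimes> a' \<otimes> r) + real (b + b' - \<beta>) * (lookup w r + t)"
        unfolding ab(3) ab'(3) elem_mult_carry[OF ab(1) ab'(1) le] by (rule lookup_mono_point[OF aa(2) lt])
      moreover have "real \<beta> * lookup w (a \<otimes> a' \<otimes> r) \<le> real \<beta> * (lookup w a + lookup w a' + lookup w r)"
        using cone_subadd3[OF w ab(1) ab'(1) r_in_H] by (intro mult_left_mono) auto
      moreover have "0 \<le> real \<beta> * t" using t by simp
      ultimately show ?thesis
        using ab ab' le by (simp add: lookup_mono_point of_nat_diff algebra_simps)
    qed
  qed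
  have "lookup (mono_point t w) \<one> = 0"
    using lookup_mono_point_H[of \<one> t w] group_cone_one[OF w] by simp
  then have "Poly_Mapping.keys (mono_point t w) \<subseteq> carrier G - {\<one>}"
    using lookup_mono_point_outside by (auto simp: in_keys_iff)
  then show ?thesis using nonneg subadd unfolding group_cone_def by simp
qed

section \<open>The inequalities whose equality case gives the shape of the face\<close>

lemma lookup_pow_le:
  assumes "x \<in> group_cone G" "g \<in> carrier G"
  shows "lookup x (g [^] (n::nat)) \<le> real n * lookup x g"
proof (induction n)
  case 0
  then show ?case using group_cone_one[OF assms(1)] by simp
next
  case (Suc n)
  then show ?case
    using group_cone_subadd[OF comm_group_G assms(1), of "g [^] n" g] assms(2) by (simp add: algebra_simps)
qed

definition defect :: "'g \<times> nat \<Rightarrow> ('g \<Rightarrow>\<^sub>0 real) \<Rightarrow> real" where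
  "defect p x = lookup x (fst p) + real (snd p) * lookup x \<rho> - lookup x (fst p \<otimes> \<rho> [^] snd p)"

lemma linear_defect: "linear (defect p)"
  by (rule linearI) (simp_all add: defect_def lookup_add lookup_scaleR algebra_simps)

lemma defect_nonneg:
  assumes "x \<in> group_cone G" "fst p \<in> H"
  shows "0 \<le> defect p x"
  using group_cone_subadd[OF comm_group_G assms(1) H_closed[OF assms(2)] rpow[of "snd p"]]
    lookup_pow_le[OF assms(1) rho, of "snd p"]
  by (simp add: defect_def)

lemma defect_mono_point:
  assumes w: "w \<in> group_cone GH" and ab: "a \<in> H" "b < \<beta>"
  shows "defect (a, b) (mono_point t w) = 0"
proof (cases "b = 0")
  case True
  then show ?thesis using ab by (simp add: defect_def H_closed)
next
  case False
  \<comment> \<open>Here \<open>0 < b < \<beta>\<close> forces \<open>1 < \<beta>\<close>, so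
    \<open>\<rho>\<close> has the coordinates \<open>(\<one>, 1)\<close>. If
    \<open>\<beta> = 1\<close>, then \<open>\<rho>\<close> lies in \<open>H\<close> and
    \<open>t\<close> does not enter its value; this is why \<open>b = 0\<close> is treated
    apart.\<close>
  then have "lookup (mono_point t w) \<rho> = lookup w r + t"
    using lookup_mono_point[of \<one> 1 t w] ab rho group_cone_one[OF w] by simp
  then show ?thesis
    using ab by (simp add: defect_def lookup_mono_point lookup_mono_point_H)
qed

lemma restrict_mono_point:
  assumes w: "w \<in> group_cone GH"
  shows "(1 / real \<beta>) *\<^sub>R pm_restrict H (mono_point t w) = w"
proof (rule poly_mapping_eqI)
  fix i
  have "lookup w i = 0" if "i \<notin> H"
    using w that by (auto simp: group_cone_def in_keys_iff)
  then show "lookup ((1 / real \<beta>) *\<^sub>R pm_restrict H (mono_point t w)) i = lookup w i"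
    using beta_pos by (auto simp: lookup_scaleR lookup_pm_restrict lookup_mono_point_H)
qed

text \<open>The first parameter is chosen so that the slope becomes \<open>lookup x \<rho>\<close>.
  The constructed point then has value \<open>lookup x a + b * lookup x \<rho>\<close> at
  \<open>a \<otimes> \<rho> [^] b\<close>, and vanishing of the defect says that \<open>x\<close>
  has this value too.\<close>

lemma mono_point_restrict:
  assumes x: "x \<in> group_cone G" and defect: "\<And>a b. a \<in> H \<Longrightarrow> b < \<beta> \<Longrightarrow> defect (a, b) x = 0"
  shows "x = mono_point (lookup x \<rho> - lookup x r / real \<beta>) ((1 / real \<beta>) *\<^sub>R pm_restrict H x)"
    (is "x = mono_point ?t ?w")
proof (rule poly_mapping_eqI)
  fix g
  show "lookup x g = lookup (mono_point ?t ?w) g"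
  proof (cases "g \<in> carrier G")
    case True
    then show ?thesis
    proof (rule coords)
      fix a b assume ab: "a \<in> H" "b < \<beta>" and g: "g = a \<otimes> \<rho> [^] (b::nat)"
      have "lookup (mono_point ?t ?w) g = lookup x a + real b * lookup x \<rho>"
        using ab r_in_H beta_pos unfolding g
        by (simp add: lookup_mono_point lookup_scaleR lookup_pm_restrict)
      then show ?thesis using defect[OF ab] by (simp add: g defect_def)
    qed
  next
    case False
    then have "lookup x g = 0" using x by (auto simp: group_cone_def in_keys_iff)
    then show ?thesis using lookup_mono_point_outside[OF False] by simp
  qed
qed

section \<open>The set of the theorem is a face\<close>

definition mono_face :: "('g \<Rightarrow>\<^sub>0 real) set \<Rightarrow> ('g \<Rightarrow>\<^sub>0 real) set" where
  "mono_face F = {mono_point t w | t w. 0 \<le> t \<and> w \<in> F}"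

lemma mono_face_subset_cone: "F \<subseteq> group_cone GH \<Longrightarrow> mono_face F \<subseteq> group_cone G"
  using mono_point_in_cone by (auto simp: mono_face_def)

text \<open>The right side intersects a zero set of nonnegative linear forms with a preimage of
  \<open>F\<close> under a linear map between the cones, so each of the two facts about
  \<open>face_of\<close> handles one part.\<close>

lemma mono_face_eq:
  assumes F: "F \<subseteq> group_cone GH"
  shows "mono_face F = {x \<in> group_cone G. \<forall>p \<in> H \<times> {..<\<beta>}. defect p x = 0}
    \<inter> {x \<in> group_cone G. (1 / real \<beta>) *\<^sub>R pm_restrict H x \<in> F}"
proof (intro subset_antisym subsetI)
  fix x assume "x \<in> mono_face F"
  then obtain t w where x: "x = mono_point t w" "0 \<le> t" "w \<in> F" by (auto simp: mono_face_def)
  then show "x \<in> {x \<in> group_cone G. \<forall>p \<in> H \<times> {..<\<beta>}. defect p x = 0}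
    \<inter> {x \<in> group_cone G. (1 / real \<beta>) *\<^sub>R pm_restrict H x \<in> F}"
    using F mono_point_in_cone defect_mono_point restrict_mono_point by auto
next
  fix x assume "x \<in> {x \<in> group_cone G. \<forall>p \<in> H \<times> {..<\<beta>}. defect p x = 0}
    \<inter> {x \<in> group_cone G. (1 / real \<beta>) *\<^sub>R pm_restrict H x \<in> F}"
  then have x: "x \<in> group_cone G" "\<And>a b. a \<in> H \<Longrightarrow> b < \<beta> \<Longrightarrow> defect (a, b) x = 0"
    "(1 / real \<beta>) *\<^sub>R pm_restrict H x \<in> F" by auto
  \<comment> \<open>The coefficient of the beta ray is nonnegative because subadditivity bounds the
    value at \<open>r\<close>, the power \<open>\<beta>\<close> of \<open>\<rho>\<close>, by
    \<open>\<beta> * lookup x \<rho>\<close>.\<close>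
  have "0 \<le> lookup x \<rho> - lookup x r / real \<beta>"
    using lookup_pow_le[OF x(1) rho, of \<beta>] beta_pos by (simp add: field_simps)
  then show "x \<in> mono_face F" using mono_point_restrict[OF x(1,2)] x(3) unfolding mono_face_def by blast
qed

lemma cone_face_mono_face:
  assumes "cone_face F (group_cone GH)"
  shows "cone_face (mono_face F) (group_cone G)"
proof -
  have F: "F face_of group_cone GH" "F \<noteq> {}" using assms by (auto simp: cone_face_def)
  have "{x \<in> group_cone G. \<forall>p \<in> H \<times> {..<\<beta>}. defect p x = 0} face_of group_cone G"
    by (rule face_of_linear_zeros) (auto intro: convex_group_cone linear_defect defect_nonneg)
  moreover have "{x \<in> group_cone G. (1 / real \<beta>) *\<^sub>R pm_restrict H x \<in> F} face_of group_cone G"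
    by (rule face_of_linear_vimage[OF _ F(1)])
       (auto intro!: convex_group_cone linear_compose_scale_right linear_pm_restrict
          scaled_pm_restrict_group_cone subgroup_H)
  ultimately have "mono_face F face_of group_cone G"
    unfolding mono_face_eq[OF face_of_imp_subset[OF F(1)]] by (rule face_of_Int)
  moreover obtain w where "w \<in> F" using F(2) by blast
  then have "mono_point 0 w \<in> mono_face F" by (auto simp: mono_face_def)
  ultimately show ?thesis by (auto simp: cone_face_def)
qed

section \<open>Kunz subgroup and Kunz poset of the new face\<close>

lemma kunz_subgroup_mono_face:
  assumes F: "F \<subseteq> group_cone GH" "F \<noteq> {}"
  shows "kunz_subgroup G (mono_face F) = kunz_subgroup GH F"
proof (intro subset_antisym subsetI)
  fix g assume "g \<in> kunz_subgroup G (mono_face F)"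
  then have g: "g \<in> carrier G" "\<And>t w. 0 \<le> t \<Longrightarrow> w \<in> F \<Longrightarrow> lookup (mono_point t w) g = 0"
    by (auto simp: kunz_subgroup_def mono_face_def)
  obtain a b where ab: "a \<in> H" "b < \<beta>" "g = a \<otimes> \<rho> [^] (b::nat)" using coords[OF g(1)] .
  obtain w where w: "w \<in> F" using F(2) by blast
  \<comment> \<open>The points with \<open>t = 0\<close> and \<open>t = 1\<close> over the same
    \<open>w\<close> differ by the beta ray, whose value at \<open>g\<close> is
    \<open>b\<close>.\<close>
  have "real b = 0"
    using g(2)[OF _ w, of 0] g(2)[OF _ w, of 1] ab by (simp add: lookup_mono_point algebra_simps)
  then have "g = a" using ab H_closed by simp
  then show "g \<in> kunz_subgroup GH F"
    using g(2)[of 0] lookup_mono_point_H[OF ab(1)] ab(1) beta_pos by (auto simp: kunz_subgroup_def)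
next
  fix g assume "g \<in> kunz_subgroup GH F"
  then show "g \<in> kunz_subgroup G (mono_face F)"
    by (auto simp: kunz_subgroup_def mono_face_def lookup_mono_point_H H_closed)
qed

text \<open>If \<open>b \<le> b'\<close>, the difference of the two elements has coordinates
  \<open>a' \<otimes> inv a\<close> and \<open>b' - b\<close>; the slope terms cancel and
  \<open>\<beta>\<close> times the relation for \<open>w\<close> is left, whatever \<open>t\<close>
  is. If \<open>b > b'\<close>, the subtraction borrows, and the slack contains the term
  \<open>\<beta> * t\<close>, so a point with \<open>t > 0\<close> violates the equation.\<close>

lemma kunz_relation_mono_face:
  assumes F: "F \<subseteq> group_cone GH" "F \<noteq> {}"
    and a: "a \<in> H" "b < \<beta>" and a': "a' \<in> H" "b' < \<beta>"
  shows "(\<forall>x \<in> mono_face F. lookup x (a \<otimes> \<rho> [^] b) + lookup x (a' \<otimes> \<rho> [^] b' \<otimes> inv (a \<otimes> \<rho> [^] b))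
        = lookup x (a' \<otimes> \<rho> [^] b'))
    \<longleftrightarrow> b \<le> b' \<and> (\<forall>w \<in> F. lookup w a + lookup w (a' \<otimes> inv a) = lookup w a')" (is "?L \<longleftrightarrow> ?R")
proof (cases "b \<le> b'")
  case True
  have d: "a' \<otimes> inv a \<in> H" using a a' by simp
  have "(a' \<otimes> inv a) \<otimes> \<rho> [^] (b' - b) \<otimes> (a \<otimes> \<rho> [^] b) = (a' \<otimes> inv a \<otimes> a) \<otimes> \<rho> [^] b'"
    using elem_mult[OF d a(1), of "b' - b" b] True by simp
  also have "a' \<otimes> inv a \<otimes> a = a'" using a a' H_closed by (simp add: m_assoc)
  finally have "a' \<otimes> \<rho> [^] b' \<otimes> inv (a \<otimes> \<rho> [^] b) = (a' \<otimes> inv a) \<otimes> \<rho> [^] (b' - b)"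
    using elem_closed a a' d by (metis inv_solve_right)
  moreover have "lookup (mono_point t w) (a \<otimes> \<rho> [^] b) + lookup (mono_point t w) ((a' \<otimes> inv a) \<otimes> \<rho> [^] (b' - b))
      = lookup (mono_point t w) (a' \<otimes> \<rho> [^] b') \<longleftrightarrow> lookup w a + lookup w (a' \<otimes> inv a) = lookup w a'" for t w
  proof -
    have "lookup (mono_point t w) (a \<otimes> \<rho> [^] b) + lookup (mono_point t w) ((a' \<otimes> inv a) \<otimes> \<rho> [^] (b' - b))
        - lookup (mono_point t w) (a' \<otimes> \<rho> [^] b') = real \<beta> * (lookup w a + lookup w (a' \<otimes> inv a) - lookup w a')"
      using a a' d True by (simp add: lookup_mono_point of_nat_diff algebra_simps)
    then show ?thesis using beta_pos by auto
  qed
  ultimately show ?thesis using True by (force simp: mono_face_def)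
next
  case False
  \<comment> \<open>The \<open>H\<close>-coordinate of the difference after borrowing:
    \<open>r\<close> is removed from \<open>a' \<otimes> inv a\<close> so that the exponent
    \<open>b' - b\<close> can be raised by \<open>\<beta>\<close>.\<close>
  define c where "c = a' \<otimes> inv a \<otimes> inv r"
  have c: "c \<in> H" using a a' r_in_H by (simp add: c_def)
  have lt: "\<beta> + b' - b < \<beta>" using False a a' by simp
  have "c \<otimes> \<rho> [^] (\<beta> + b' - b) \<otimes> (a \<otimes> \<rho> [^] b) = (c \<otimes> a \<otimes> r) \<otimes> \<rho> [^] b'"
    using elem_mult_carry[OF c a(1), of "\<beta> + b' - b" b] a by simp
  also have ca: "c \<otimes> a \<otimes> r = a'"
  proof -
    have "c \<otimes> a \<otimes> r = a' \<otimes> (inv a \<otimes> a) \<otimes> (inv r \<otimes> r)"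
      using a a' H_closed rpow unfolding c_def by (simp only: m_ac inv_closed m_closed)
    then show ?thesis using a a' H_closed rpow by simp
  qed
  finally have eq: "a' \<otimes> \<rho> [^] b' \<otimes> inv (a \<otimes> \<rho> [^] b) = c \<otimes> \<rho> [^] (\<beta> + b' - b)"
    using elem_closed a a' c by (metis inv_solve_right)
  obtain w where w: "w \<in> F" using F(2) by blast
  have "lookup w a' \<le> lookup w c + lookup w a + lookup w r"
    using cone_subadd3[of w c a r] F(1) w c a r_in_H ca by auto
  then have "real \<beta> * lookup w a' \<le> real \<beta> * (lookup w c + lookup w a + lookup w r)"
    by (intro mult_left_mono) auto
  \<comment> \<open>The final summand \<open>real \<beta>\<close> comes from \<open>t = 1\<close>;
    the other terms are nonnegative together by the preceding inequality.\<close>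
  moreover have "lookup (mono_point 1 w) (a \<otimes> \<rho> [^] b) + lookup (mono_point 1 w) (c \<otimes> \<rho> [^] (\<beta> + b' - b))
        - lookup (mono_point 1 w) (a' \<otimes> \<rho> [^] b')
      = real \<beta> * (lookup w c + lookup w a + lookup w r) - real \<beta> * lookup w a' + real \<beta>"
    using a a' c lt by (simp add: lookup_mono_point of_nat_diff algebra_simps)
  ultimately have "lookup (mono_point 1 w) (a \<otimes> \<rho> [^] b) + lookup (mono_point 1 w) (c \<otimes> \<rho> [^] (\<beta> + b' - b))
      \<noteq> lookup (mono_point 1 w) (a' \<otimes> \<rho> [^] b')"
    using beta_pos by linarith
  moreover have "mono_point 1 w \<in> mono_face F" using w by (force simp: mono_face_def)
  ultimately have "\<not> ?L" unfolding eq by blast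
  then show ?thesis using False by blast
qed

lemma kunz_poset_mono_face:
  assumes F: "F \<subseteq> group_cone GH" "F \<noteq> {}"
  shows "kunz_poset G (mono_face F) = mono_extension G H (kunz_subgroup GH F) \<rho> (kunz_poset GH F)"
proof -
  define K where "K = kunz_subgroup GH F"
  have KG: "kunz_subgroup G (mono_face F) = K" using kunz_subgroup_mono_face[OF F] by (simp add: K_def)
  have K: "K \<subseteq> carrier G" using H_closed by (auto simp: K_def kunz_subgroup_def)
  \<comment> \<open>Cosets of \<open>K\<close> formed inside \<open>H\<close> are literally cosets
    in \<open>G\<close>, so both posets can be compared on the representatives \<open>a\<close> and
    \<open>a \<otimes> \<rho> [^] b\<close>.\<close>
  have coset_GH: "K #>\<^bsub>GH\<^esub> a = K #> a" for a by (simp add: r_coset_def)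
  have fstP: "fst (kunz_poset GH F) = (\<lambda>a. K #> a) ` H"
    by (simp add: kunz_poset_def Let_def carrier_FactGroup K_def flip: coset_GH)
  have fstQ: "fst (kunz_poset G (mono_face F)) = carrier (G Mod K)"
    by (simp add: kunz_poset_def Let_def KG)
  have relP: "(K #> a, K #> a') \<in> snd (kunz_poset GH F)
      \<longleftrightarrow> (\<forall>w \<in> F. lookup w a + lookup w (a' \<otimes> inv a) = lookup w a')" if "a \<in> H" "a' \<in> H" for a a'
    using kunz_poset_rel_iff[OF comm_group_GH finite_GH F(1), of a a'] that m_inv_consistent[OF subgroup_H]
    by (simp add: coset_GH flip: K_def)
  have relQ: "(K #> (a \<otimes> \<rho> [^] b), K #> (a' \<otimes> \<rho> [^] b')) \<in> snd (kunz_poset G (mono_face F))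
      \<longleftrightarrow> b \<le> b' \<and> (K #> a, K #> a') \<in> snd (kunz_poset GH F)"
    if "a \<in> H" "b < \<beta>" "a' \<in> H" "b' < \<beta>" for a a' and b b' :: nat
    using kunz_poset_rel_iff[OF comm_group_G finite_G mono_face_subset_cone[OF F(1)]
        elem_closed[OF that(1)] elem_closed[OF that(3)]]
      kunz_relation_mono_face[OF F that] relP[OF that(1,3)] unfolding KG by blast
  have shift: "(K #> a) #> \<rho> [^] (b::nat) = K #> (a \<otimes> \<rho> [^] b)" if "a \<in> H" for a b
    using coset_mult_assoc[OF K H_closed[OF that] rpow] .
  have "snd (kunz_poset G (mono_face F)) =
      {(A #> (\<rho> [^] b), A' #> (\<rho> [^] b')) | A A' b b'.
         A \<in> fst (kunz_poset GH F) \<and> A' \<in> fst (kunz_poset GH F) \<and> b < \<beta> \<and> b' < \<beta> \<and>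
         (A, A') \<in> snd (kunz_poset GH F) \<and> b \<le> b'}" (is "_ = ?R")
  proof (intro subset_antisym subrelI)
    fix B B' assume BB: "(B, B') \<in> snd (kunz_poset G (mono_face F))"
    then have "B \<in> carrier (G Mod K)" "B' \<in> carrier (G Mod K)"
      by (auto simp: kunz_poset_def Let_def KG)
    then obtain g g' where g: "g \<in> carrier G" "g' \<in> carrier G" "B = K #> g" "B' = K #> g'"
      by (auto simp: carrier_FactGroup)
    obtain a b where ab: "a \<in> H" "b < \<beta>" "g = a \<otimes> \<rho> [^] (b::nat)" using coords[OF g(1)] .
    obtain a' b' where ab': "a' \<in> H" "b' < \<beta>" "g' = a' \<otimes> \<rho> [^] (b'::nat)" using coords[OF g(2)] .
    have "b \<le> b' \<and> (K #> a, K #> a') \<in> snd (kunz_poset GH F)"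
      using BB relQ[OF ab(1,2) ab'(1,2)] g ab ab' by simp
    moreover have "B = (K #> a) #> \<rho> [^] b" "B' = (K #> a') #> \<rho> [^] b'"
      using shift g ab ab' by simp_all
    ultimately show "(B, B') \<in> ?R" using ab ab' fstP by blast
  next
    fix B B' assume "(B, B') \<in> ?R"
    then obtain a a' b b' where "B = (K #> a) #> \<rho> [^] (b::nat)" "B' = (K #> a') #> \<rho> [^] (b'::nat)"
      "a \<in> H" "a' \<in> H" "b < \<beta>" "b' < \<beta>" "(K #> a, K #> a') \<in> snd (kunz_poset GH F)" "b \<le> b'"
      unfolding fstP by blast
    then show "(B, B') \<in> snd (kunz_poset G (mono_face F))" using relQ shift by simp
  qed
  then show ?thesis
    unfolding mono_extension_def K_def[symmetric] fstQ[symmetric] by (metis prod.collapse)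
qed

end

theorem theorem6p10:
  fixes G :: "('g, 'm) monoid_scheme" (structure)
    and H :: "'g set" and \<rho> :: 'g and F :: "('g \<Rightarrow>\<^sub>0 real) set"
  assumes "comm_group G" and "finite (carrier G)"
    and "subgroup H G" and "cyclic_group (G Mod H)"
    and "\<rho> \<in> carrier G" and "subgroup_generated (G Mod H) {H #> \<rho>} = G Mod H"
    and "cone_face F (group_cone (G\<lparr>carrier := H\<rparr>))"
  shows "let E = {t *\<^sub>R beta_ray G H \<rho> + mono_emb G H \<rho> w | t w. 0 \<le> t \<and> w \<in> F} in
           cone_face E (group_cone G) \<and>
           kunz_poset G E =
             mono_extension G H (kunz_subgroup (G\<lparr>carrier := H\<rparr>) F) \<rho>
               (kunz_poset (G\<lparr>carrier := H\<rparr>) F)"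
proof -
  interpret monoscopic G H \<rho>
    using assms by (intro monoscopic.intro monoscopic_axioms.intro)
  have "F \<subseteq> group_cone GH" "F \<noteq> {}"
    using assms(7) by (auto simp: cone_face_def dest: face_of_imp_subset)
  then show ?thesis
    using cone_face_mono_face[OF assms(7)] kunz_poset_mono_face
    unfolding Let_def mono_face_def mono_point_def by blast
qed

end
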